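(* Let $(\mathcal{X},\mathcal{F},\sigma)$ be a probability space with an $\alpha$-homogeneous atomic filtration, $0<\alpha\le1/2$, and let $f\in L^1(\mathcal{X})$ satisfy $\|S(f)\|_\infty<\infty$. Then for every $\lambda\ge0$ \[ \bigl|\{x\in\mathcal{X}: f(x)-\mathbb{E}f>\lambda\}\bigr|\le e^{-\alpha\lambda^2/\|Sf\|_\infty^2}. \]
   Context: An atomic filtration on a probability space $(\mathcal{X},\mathcal{F},\sigma)$ is an increasing sequence of $\sigma$-algebras $\mathcal{F}_n\subset\mathcal{F}$, $n\ge0$, with $\mathcal{F}_0=\{\varnothing,\mathcal{X}\}$, $\mathcal{F}$ generated by the $\mathcal{F}_n$, and such that for each $n$ there is a countable collection $\mathcal{D}_n$ of disjoint sets ("cubes") with every set of $\mathcal{F}_n$ a union of sets of $\mathcal{D}_n$. Write $\mathcal{D}=\bigcup_n\mathcal{D}_n$, $|A|=\sigma(A)$, and for $Q\in\mathcal{D}_n$ let $\operatorname{ch}Q=\{R\in\mathcal{D}_{n+1}:R\subset Q\}$. The filtration is $\alpha$-homogeneous if $|Q'|\ge\alpha|Q|$ for every cube $Q$ and every $Q'\in\operatorname{ch}Q$. For $|A|>0$, $\langle f\rangle_A=|A|^{-1}\int_A f$; $\mathbb{E}f=\langle f\rangle_{\mathcal{X}}$. Let $\mathbf{E}_Q f=\langle f\rangle_Q\mathbf{1}_Q$, $\Delta_Q=\sum_{R\in\operatorname{ch}Q}\mathbf{E}_R-\mathbf{E}_Q$, and $S f=\bigl(\sum_{Q\in\mathcal{D}}|\Delta_Q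 f|^2\bigr)^{1/2}$. *)

theory Defs
  imports "HOL-Probability.Probability"
begin

definition atomic_filtration ::
  "'a measure \<Rightarrow> (nat \<Rightarrow> 'a set set) \<Rightarrow> (nat \<Rightarrow> 'a set set) \<Rightarrow> bool" where
  "atomic_filtration M F D \<longleftrightarrow>
     (\<forall>n. sigma_algebra (space M) (F n) \<and> F n \<subseteq> sets M) \<and>
     (\<forall>n. F n \<subseteq> F (Suc n)) \<and>
     F 0 = {{}, space M} \<and>
     sets M = sigma_sets (space M) (\<Union>n. F n) \<and>
     (\<forall>n. countable (D n) \<and> disjoint (D n) \<and> D n \<subseteq> F n \<and>
          (\<forall>A\<in>F n. \<exists>C\<subseteq>D n. A = \<Union>C))"

definition ch :: "(nat \<Rightarrow> 'a set set) \<Rightarrow> nat \<Rightarrow> 'a set \<Rightarrow> 'a set set" where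
  "ch D n Q = {R \<in> D (Suc n). R \<subseteq> Q}"

definition homogeneous :: "'a measure \<Rightarrow> (nat \<Rightarrow> 'a set set) \<Rightarrow> real \<Rightarrow> bool" where
  "homogeneous M D \<alpha> \<longleftrightarrow>
     (\<forall>n. \<forall>Q\<in>D n. \<forall>Q'\<in>ch D n Q. measure M Q' \<ge> \<alpha> * measure M Q)"

definition avg :: "'a measure \<Rightarrow> ('a \<Rightarrow> real) \<Rightarrow> 'a set \<Rightarrow> real" where
  "avg M f A = (LINT x:A|M. f x) / measure M A"

definition condE :: "'a measure \<Rightarrow> 'a set \<Rightarrow> ('a \<Rightarrow> real) \<Rightarrow> 'a \<Rightarrow> real" where
  "condE M Q f x = avg M f Q * indicator Q x"

definition mdiff :: "'a measure \<Rightarrow> (nat \<Rightarrow> 'a set set) \<Rightarrow> nat \<Rightarrow> 'a set \<Rightarrow> ('a \<Rightarrow> real) \<Rightarrow> 'a \<Rightarrow> real" where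
  "mdiff M D n Q f x = (\<Sum>\<^sub>\<infinity>R\<in>ch D n Q. condE M R f x) - condE M Q f x"

definition sq_sum :: "'a measure \<Rightarrow> (nat \<Rightarrow> 'a set set) \<Rightarrow> ('a \<Rightarrow> real) \<Rightarrow> 'a \<Rightarrow> ennreal" where
  "sq_sum M D f x = (\<Sum>n. \<Sum>\<^sub>\<infinity>Q\<in>D n. ennreal ((mdiff M D n Q f x)\<^sup>2))"

definition square_fun :: "'a measure \<Rightarrow> (nat \<Rightarrow> 'a set set) \<Rightarrow> ('a \<Rightarrow> real) \<Rightarrow> 'a \<Rightarrow> ennreal" where
  "square_fun M D f x =
     (if sq_sum M D f x = \<infinity> then \<infinity> else ennreal (sqrt (enn2real (sq_sum M D f x))))"

end

theory Submission
  imports Defs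
begin

text \<open>
  Let \<open>X\<^sub>n\<close> be the average of \<open>f\<close> over the cube of generation \<open>n\<close>, and \<open>d\<^sub>n = X\<^sub>n\<^sub>+\<^sub>1 - X\<^sub>n\<close>. The process
  \<open>exp (t (X\<^sub>n - X\<^sub>0) - t\<^sup>2/(4\<alpha>) (d\<^sub>0\<^sup>2 + \<dots> + d\<^sub>n\<^sub>-\<^sub>1\<^sup>2))\<close> is a supermartingale: this amounts to the inequality
  \<open>\<Sum> p\<^sub>i exp (x\<^sub>i - x\<^sub>i\<^sup>2/(4\<alpha>)) \<le> 1\<close> for weights \<open>p\<^sub>i \<ge> \<alpha>\<close> of total mass 1 with \<open>\<Sum> p\<^sub>i x\<^sub>i = 0\<close>. A convexity
  argument moves everything far on the negative side into one atom of weight \<open>\<alpha>\<close>, a tangent line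
  merges the rest, and the remaining two-point inequality is checked where its derivative is
  nonnegative. Since \<open>X\<^sub>n\<close> tends to \<open>f\<close> in \<open>L\<^sup>1\<close>, Fatou's lemma gives
  \<open>E exp (t (f - E f)) \<le> exp (t\<^sup>2 S\<^sup>2/(4\<alpha>))\<close> with \<open>S\<close> the supremum norm of the square function, and
  Markov's inequality with \<open>t = 2\<alpha>\<lambda>/S\<^sup>2\<close> concludes.
\<close>

section \<open>The inequality for one step\<close>

text \<open>The factor gained by the supermartingale in one step, with \<open>x\<close> equal to
  \<open>t\<close> times the increment. Completing the square shows a Gaussian bump with peak
  \<open>exp \<alpha>\<close> at \<open>2 * \<alpha>\<close>.\<close>

definition gtilt :: "real \<Rightarrow> real \<Rightarrow> real" where
  "gtilt \<alpha> x = exp (x - x\<^sup>2 / (4 * \<alpha>))"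

lemma gtilt_pos: "0 < gtilt \<alpha> x"
  by (simp add: gtilt_def)

lemma gtilt_0 [simp]: "gtilt \<alpha> 0 = 1"
  by (simp add: gtilt_def)

lemma gtilt_le_exp:
  assumes "0 < \<alpha>"
  shows "gtilt \<alpha> x \<le> exp \<alpha>"
proof -
  have "\<alpha> - (x - x\<^sup>2 / (4 * \<alpha>)) = (x - 2 * \<alpha>)\<^sup>2 / (4 * \<alpha>)"
    using assms by (simp add: field_simps power2_eq_square)
  also have "\<dots> \<ge> 0" using assms by simp
  finally show ?thesis by (simp add: gtilt_def)
qed

lemma gtilt_peak: "0 < \<alpha> \<Longrightarrow> gtilt \<alpha> (2 * \<alpha>) = exp \<alpha>"
  by (simp add: gtilt_def power2_eq_square)

lemma gtilt_deriv [derivative_intros]: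
  assumes "(h has_real_derivative h') (at x within S)" and "0 < \<alpha>"
  shows "((\<lambda>x. gtilt \<alpha> (h x)) has_real_derivative gtilt \<alpha> (h x) * (1 - h x / (2 * \<alpha>)) * h') (at x within S)"
  unfolding gtilt_def using assms
  by (auto intro!: derivative_eq_intros simp: field_simps power2_eq_square)

lemma gtilt_deriv2:
  assumes "0 < \<alpha>"
  shows "((\<lambda>x. gtilt \<alpha> x * (1 - x / (2 * \<alpha>))) has_real_derivative
      gtilt \<alpha> x * ((x - 2 * \<alpha>)\<^sup>2 - 2 * \<alpha>) / (4 * \<alpha>\<^sup>2)) (at x within S)"
  using assms
  by (auto intro!: derivative_eq_intros simp: field_simps power2_eq_square)

lemma gtilt_mono:
  assumes "0 < \<alpha>" "x \<le> y" "y \<le> 2 * \<alpha>"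
  shows "gtilt \<alpha> x \<le> gtilt \<alpha> y"
proof -
  have "(y - y\<^sup>2 / (4 * \<alpha>)) - (x - x\<^sup>2 / (4 * \<alpha>)) = (y - x) * (4 * \<alpha> - (x + y)) / (4 * \<alpha>)"
    using assms by (simp add: field_simps power2_eq_square)
  also have "\<dots> \<ge> 0" using assms by simp
  finally show ?thesis by (simp add: gtilt_def)
qed

text \<open>The second derivative has the sign of
  \<open>(x - 2 * \<alpha>)^2 - 2 * \<alpha>\<close>, nonnegative up to the left inflection
  point.\<close>

lemma gtilt_convex:
  assumes "0 < \<alpha>"
  shows "convex_on {..2 * \<alpha> - sqrt (2 * \<alpha>)} (gtilt \<alpha>)"
proof (rule f''_ge0_imp_convex[where f' = "\<lambda>x. gtilt \<alpha> x * (1 - x / (2 * \<alpha>))"])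
  fix x assume x: "x \<in> {..2 * \<alpha> - sqrt (2 * \<alpha>)}"
  show "(gtilt \<alpha> has_real_derivative gtilt \<alpha> x * (1 - x / (2 * \<alpha>))) (at x)"
    using gtilt_deriv[OF DERIV_ident assms] by simp
  show "((\<lambda>x. gtilt \<alpha> x * (1 - x / (2 * \<alpha>))) has_real_derivative
      gtilt \<alpha> x * ((x - 2 * \<alpha>)\<^sup>2 - 2 * \<alpha>) / (4 * \<alpha>\<^sup>2)) (at x)"
    by (rule gtilt_deriv2[OF assms])
  have "(sqrt (2 * \<alpha>))\<^sup>2 \<le> (2 * \<alpha> - x)\<^sup>2"
    using x assms by (intro power_mono) auto
  then have "2 * \<alpha> \<le> (x - 2 * \<alpha>)\<^sup>2"
    using assms by (simp add: power2_commute)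
  then show "0 \<le> gtilt \<alpha> x * ((x - 2 * \<alpha>)\<^sup>2 - 2 * \<alpha>) / (4 * \<alpha>\<^sup>2)"
    using gtilt_pos[of \<alpha> x] by (intro divide_nonneg_nonneg mult_nonneg_nonneg) auto
qed simp

text \<open>From the left inflection point to the peak the tilt is concave, so its tangents lie
  above it. Beyond the peak the tilt stays below its peak value, while a tangent of nonnegative
  slope does not fall.\<close>

lemma gtilt_below_tangent:
  assumes a: "0 < \<alpha>" and y: "2 * \<alpha> - sqrt (2 * \<alpha>) \<le> y" "y \<le> 2 * \<alpha>"
    and x: "2 * \<alpha> - sqrt (2 * \<alpha>) \<le> x"
  shows "gtilt \<alpha> x \<le> gtilt \<alpha> y + gtilt \<alpha> y * (1 - y / (2 * \<alpha>)) * (x - y)"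
proof -
  let ?C = "{2 * \<alpha> - sqrt (2 * \<alpha>)..2 * \<alpha>}"
  let ?sl = "gtilt \<alpha> y * (1 - y / (2 * \<alpha>))"
  have sl: "0 \<le> ?sl"
    using gtilt_pos[of \<alpha> y] y a by simp
  have *: "- gtilt \<alpha> z - - gtilt \<alpha> y \<ge> - gtilt \<alpha> y * (1 - y / (2 * \<alpha>)) * (z - y)" if z: "z \<in> ?C" for z
  proof (rule f''_imp_f'[where f = "\<lambda>x. - gtilt \<alpha> x" and C = "?C"
        and f' = "\<lambda>x. - gtilt \<alpha> x * (1 - x / (2 * \<alpha>))"
        and f'' = "\<lambda>x. - (gtilt \<alpha> x * ((x - 2 * \<alpha>)\<^sup>2 - 2 * \<alpha>) / (4 * \<alpha>\<^sup>2))"])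
    fix x assume x: "x \<in> ?C"
    show "((\<lambda>x. - gtilt \<alpha> x) has_real_derivative - gtilt \<alpha> x * (1 - x / (2 * \<alpha>))) (at x)"
      using DERIV_minus[OF gtilt_deriv[OF DERIV_ident a]] by simp
    show "((\<lambda>x. - gtilt \<alpha> x * (1 - x / (2 * \<alpha>))) has_real_derivative
      - (gtilt \<alpha> x * ((x - 2 * \<alpha>)\<^sup>2 - 2 * \<alpha>) / (4 * \<alpha>\<^sup>2))) (at x)"
      using DERIV_minus[OF gtilt_deriv2[OF a]] by simp
    have "(2 * \<alpha> - x)\<^sup>2 \<le> (sqrt (2 * \<alpha>))\<^sup>2"
      using x a by (intro power_mono) auto
    then have "(x - 2 * \<alpha>)\<^sup>2 - 2 * \<alpha> \<le> 0"
      using a by (simp add: power2_commute)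
    then show "0 \<le> - (gtilt \<alpha> x * ((x - 2 * \<alpha>)\<^sup>2 - 2 * \<alpha>) / (4 * \<alpha>\<^sup>2))"
      using gtilt_pos[of \<alpha> x]
      by (simp add: divide_nonpos_nonneg mult_nonneg_nonpos)
  qed (use y z in auto)
  show ?thesis
  proof (cases "x \<le> 2 * \<alpha>")
    case True
    then show ?thesis using *[of x] x by simp
  next
    case False
    have "gtilt \<alpha> x \<le> gtilt \<alpha> (2 * \<alpha>)"
      using gtilt_le_exp[OF a] gtilt_peak[OF a] by simp
    also have "\<dots> \<le> gtilt \<alpha> y + ?sl * (2 * \<alpha> - y)"
      using *[of "2 * \<alpha>"] a by simp
    also have "?sl * (2 * \<alpha> - y) \<le> ?sl * (x - y)"
      using False sl by (intro mult_left_mono) auto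
    finally show ?thesis by simp
  qed
qed

section \<open>The two-point case\<close>

text \<open>Second-order truncation of the series of \<open>ln (1 - x)\<close>. Arguing through the
  decreasing function \<open>?h\<close> also covers \<open>x \<ge> 1\<close>.\<close>

lemma one_minus_le_exp_quadratic:
  fixes x :: real
  assumes "0 \<le> x"
  shows "1 - x \<le> exp (- x - x\<^sup>2 / 2)"
proof -
  let ?h = "\<lambda>x::real. (1 - x) * exp (x + x\<^sup>2 / 2)"
  have "?h x \<le> ?h 0"
  proof (rule DERIV_nonpos_imp_nonincreasing[OF assms])
    fix z :: real
    have "(?h has_real_derivative - z\<^sup>2 * exp (z + z\<^sup>2 / 2)) (at z)"
      by (auto intro!: derivative_eq_intros simp: algebra_simps power2_eq_square)
    then show "\<exists>y. (?h has_real_derivative y) (at z) \<and> y \<le> 0"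
      by (auto simp: mult_nonpos_nonneg)
  qed
  then have "?h x * exp (- x - x\<^sup>2 / 2) \<le> 1 * exp (- x - x\<^sup>2 / 2)"
    by (intro mult_right_mono) auto
  also have "?h x * exp (- x - x\<^sup>2 / 2) = (1 - x) * exp ((x + x\<^sup>2 / 2) + (- x - x\<^sup>2 / 2))"
    unfolding exp_add by simp
  also have "\<dots> = 1 - x" by simp
  finally show ?thesis by simp
qed

text \<open>The left-hand side is the value of the two-point sum of the next lemma at \<open>s = 2u\<close>, once
  a nonnegative derivative there has been used to eliminate the atom of weight \<open>\<alpha>\<close>.\<close>

lemma two_point_critical:
  assumes a: "0 < \<alpha>" "\<alpha> \<le> 1/2" and u: "0 \<le> u" "u \<le> (1::real)"
    and w: "w = \<alpha> + (1 - \<alpha>) * u"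
  shows "exp (\<alpha> * (2 * u - u\<^sup>2)) * (1 - \<alpha> * u / w) \<le> 1"
proof -
  have w0: "0 < w" unfolding w using a u by (intro add_pos_nonneg) auto
  \<comment> \<open>The left-hand side is concave in \<open>\<alpha>\<close>; the right-hand side is its interpolation between
     \<open>\<alpha> = 0\<close> and \<open>\<alpha> = 1/2\<close> plus the concavity defect.\<close>
  have "2 * w + \<alpha> * u - 2 * (2 - u) * w\<^sup>2 =
     (1 - 2 * \<alpha>) * (2 * u * (1 - u)\<^sup>2) + 2 * \<alpha> * (u ^ 3 / 2)
     + \<alpha> * (1 - 2 * \<alpha>) * ((2 - u) * (1 - u)\<^sup>2)"
    unfolding w by (simp add: algebra_simps power2_eq_square power3_eq_cube)
  also have "\<dots> \<ge> 0"
    using a u by (intro add_nonneg_nonneg mult_nonneg_nonneg) auto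
  finally have K: "2 * (2 - u) * w\<^sup>2 \<le> 2 * w + \<alpha> * u" by simp
  \<comment> \<open>In terms of this \<open>x\<close>, \<open>K\<close> bounds the exponent by
    \<open>x + x^2 / 2\<close>, which the truncated logarithm absorbs.\<close>
  define x where "x = \<alpha> * u / w"
  have "\<alpha> * (2 * u - u\<^sup>2) = \<alpha> * u * (2 * (2 - u) * w\<^sup>2) / (2 * w\<^sup>2)"
    using w0 by (simp add: field_simps power2_eq_square)
  also have "\<dots> \<le> \<alpha> * u * (2 * w + \<alpha> * u) / (2 * w\<^sup>2)"
    using K a u by (intro divide_right_mono mult_left_mono) auto
  also have "\<dots> = x + x\<^sup>2 / 2"
    using w0 by (simp add: x_def field_simps power2_eq_square)
  finally have 1: "\<alpha> * (2 * u - u\<^sup>2) \<le> x + x\<^sup>2 / 2" .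
  have "0 \<le> x" using a u w0 by (simp add: x_def)
  then have "1 - x \<le> exp (- x - x\<^sup>2 / 2)" by (rule one_minus_le_exp_quadratic)
  then have "exp (\<alpha> * (2 * u - u\<^sup>2)) * (1 - x) \<le> exp (\<alpha> * (2 * u - u\<^sup>2)) * exp (- x - x\<^sup>2 / 2)"
    by simp
  also have "\<dots> = exp (\<alpha> * (2 * u - u\<^sup>2) - (x + x\<^sup>2 / 2))"
    by (simp add: exp_add[symmetric] algebra_simps)
  also have "\<dots> \<le> 1" using 1 by simp
  finally show ?thesis by (simp add: x_def)
qed

text \<open>Instead of monotonicity in \<open>s\<close>, the proof inspects a maximiser
  \<open>z\<close> on \<open>[0, s]\<close>. At 0 the value is 1; at \<open>z > 0\<close> the
  derivative cannot be negative, which bounds the tilt at the left point by the tilt at the right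
  one.\<close>

lemma two_point_inequality:
  assumes a: "0 < \<alpha>" "\<alpha> \<le> 1/2" and s: "0 \<le> s" "s \<le> 2"
  shows "\<alpha> * gtilt \<alpha> (- (1 - \<alpha>) * s) + (1 - \<alpha>) * gtilt \<alpha> (\<alpha> * s) \<le> 1"
proof -
  define F where "F s = \<alpha> * gtilt \<alpha> (- (1 - \<alpha>) * s) + (1 - \<alpha>) * gtilt \<alpha> (\<alpha> * s)" for s
  define F' where "F' s = \<alpha> * (1 - \<alpha>) *
     (gtilt \<alpha> (\<alpha> * s) * (1 - s / 2) - gtilt \<alpha> (- (1 - \<alpha>) * s) * (1 + (1 - \<alpha>) * s / (2 * \<alpha>)))" for s
  have der: "(F has_real_derivative F' s) (at s)" for s
    unfolding F_def[abs_def] F'_def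
    by (rule derivative_eq_intros refl a | use a in \<open>simp add: field_simps\<close>)+
  have "continuous_on {0..s} F"
    using der by (intro DERIV_continuous_on) (blast intro: DERIV_subset)
  then obtain z where z: "z \<in> {0..s}" and max: "\<And>y. y \<in> {0..s} \<Longrightarrow> F y \<le> F z"
    using continuous_attains_sup[of "{0..s}" F] s by auto
  have "F z \<le> 1"
  proof (cases "z = 0")
    case True
    then show ?thesis by (simp add: F_def)
  next
    case False
    with z have z0: "0 < z" by simp
    \<comment> \<open>As \<open>z\<close> may be the right endpoint, only a sign is available: a
      negative derivative would make \<open>F\<close> larger just to the left of
      \<open>z\<close>.\<close>
    have "0 \<le> F' z"
    proof (rule ccontr)
      assume "\<not> 0 \<le> F' z"
      then obtain e where e: "e > 0" "\<And>h. 0 < h \<Longrightarrow> h < e \<Longrightarrow> F z < F (z - h)"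
        using DERIV_neg_dec_left[OF der, of z] by auto
      define h where "h = min z (e / 2)"
      have "0 < h" "h < e" "h \<le> z" using z0 e(1) by (auto simp: h_def)
      then show False using e(2)[of h] max[of "z - h"] z by force
    qed
    define u where "u = z / 2"
    define w where "w = \<alpha> + (1 - \<alpha>) * u"
    define A B where "A = gtilt \<alpha> (- (1 - \<alpha>) * z)" and "B = gtilt \<alpha> (\<alpha> * z)"
    have u: "0 \<le> u" "u \<le> 1" using z s by (auto simp: u_def)
    have w0: "0 < w" unfolding w_def using a u by (intro add_pos_nonneg) auto
    have "0 < \<alpha> * (1 - \<alpha>)" using a by simp
    then have "0 \<le> B * (1 - z / 2) - A * (1 + (1 - \<alpha>) * z / (2 * \<alpha>))"
      using \<open>0 \<le> F' z\<close> unfolding F'_def A_def B_def by (metis zero_le_mult_iff not_le)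
    \<comment> \<open>The factor \<alpha> turns the coefficient of \<open>A\<close> into
      \<open>w\<close>.\<close>
    then have "0 \<le> \<alpha> * (B * (1 - z / 2) - A * (1 + (1 - \<alpha>) * z / (2 * \<alpha>)))"
      using a by simp
    also have "\<dots> = \<alpha> * B * (1 - u) - A * w"
      using a by (simp add: w_def u_def field_simps)
    finally have "A \<le> \<alpha> * B * (1 - u) / w"
      using w0 by (simp add: field_simps)
    then have "\<alpha> * A \<le> \<alpha> * (\<alpha> * B * (1 - u) / w)"
      using a by (intro mult_left_mono) auto
    then have "F z \<le> \<alpha> * (\<alpha> * B * (1 - u) / w) + (1 - \<alpha>) * B"
      unfolding F_def A_def B_def by simp
    also have "\<dots> = B * ((\<alpha>\<^sup>2 * (1 - u) + (1 - \<alpha>) * w) / w)"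
      using w0 by (simp add: field_simps power2_eq_square)
    also have "\<alpha>\<^sup>2 * (1 - u) + (1 - \<alpha>) * w = w - \<alpha> * u"
      by (simp add: w_def algebra_simps power2_eq_square)
    also have "(w - \<alpha> * u) / w = 1 - \<alpha> * u / w"
      using w0 by (simp add: field_simps)
    also have "B = exp (\<alpha> * (2 * u - u\<^sup>2))"
      using a by (simp add: B_def gtilt_def u_def field_simps power2_eq_square)
    also have "exp (\<alpha> * (2 * u - u\<^sup>2)) * (1 - \<alpha> * u / w) \<le> 1"
      by (rule two_point_critical[OF a u w_def])
    finally show ?thesis .
  qed
  with max[of s] s have "F s \<le> 1" by auto
  then show ?thesis by (simp add: F_def)
qed

section \<open>Reduction of a centred distribution to two points\<close>

lemma gtilt_centered_sum_le_one:
  fixes p d :: "'i \<Rightarrow> real"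
  assumes a: "0 < \<alpha>" "\<alpha> \<le> 1/2" and I: "finite I"
    and p: "\<And>i. i \<in> I \<Longrightarrow> \<alpha> \<le> p i" and p1: "sum p I = 1"
    and mean: "(\<Sum>i\<in>I. p i * d i) = 0"
  shows "(\<Sum>i\<in>I. p i * gtilt \<alpha> (d i)) \<le> 1"
proof -
  \<comment> \<open>\<open>\<tau>\<close> is the left inflection point of the tilt: the tilt is convex below it, and tangents
     taken on \<open>[0, 2\<alpha>]\<close> dominate the tilt above it.\<close>
  define \<tau> where "\<tau> = 2 * \<alpha> - sqrt (2 * \<alpha>)"
  \<comment> \<open>Here \<open>\<alpha> \<le> 1/2\<close> puts the inflection point to the left of
    0, so tangents may be taken at every point of \<open>[0, 2 * \<alpha>]\<close>.\<close>
  have "(2 * \<alpha>) * (2 * \<alpha>) \<le> 2 * \<alpha>"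
    using a by (simp add: mult_le_cancel_left1)
  then have "2 * \<alpha> \<le> sqrt (2 * \<alpha>)"
    by (intro real_le_rsqrt) (simp add: power2_eq_square)
  then have \<tau>0: "\<tau> \<le> 0" by (simp add: \<tau>_def)
  have p0: "0 \<le> p i" if "i \<in> I" for i using p[OF that] a by simp
  \<comment> \<open>\<open>d'\<close> clips the points at \<open>\<tau>\<close> and \<open>e\<close>
    records the displacement; since \<open>d\<close> is centred, the clipped points have mean
    \<open>T\<close>.\<close>
  define e where "e i = max (\<tau> - d i) 0" for i
  define d' where "d' i = max (d i) \<tau>" for i
  define T where "T = (\<Sum>i\<in>I. p i * e i)"
  have d'_eq: "d' i = d i + e i" for i by (simp add: d'_def e_def)
  have e0: "0 \<le> e i" for i by (simp add: e_def)
  have T0: "0 \<le> T" unfolding T_def using p0 e0 by (intro sum_nonneg) auto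
  have sum_d': "(\<Sum>i\<in>I. p i * d' i) = T"
    by (simp add: d'_eq distrib_left sum.distrib mean T_def)
  define line where "line y x = gtilt \<alpha> y + gtilt \<alpha> y * (1 - y / (2 * \<alpha>)) * (x - y)" for y x
  have line: "gtilt \<alpha> x \<le> line y x" if "0 \<le> y" "y \<le> 2 * \<alpha>" "\<tau> \<le> x" for x y
    unfolding line_def using gtilt_below_tangent[of \<alpha> y x] that a \<tau>0 unfolding \<tau>_def by simp
  \<comment> \<open>A tangent is affine and the weights have total 1, so averaging it evaluates it
    at the mean.\<close>
  have sum_line: "(\<Sum>i\<in>I. p i * line y (d' i)) = line y T" for y
  proof -
    define k where "k = gtilt \<alpha> y * (1 - y / (2 * \<alpha>))"
    have line_def: "line y x = gtilt \<alpha> y + k * (x - y)" for x by (simp add: line_def k_def)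
    have "(\<Sum>i\<in>I. p i * line y (d' i)) = (\<Sum>i\<in>I. p i * line y 0 + k * (p i * d' i))"
      by (intro sum.cong refl) (simp add: line_def algebra_simps)
    also have "\<dots> = line y 0 + k * T"
      by (simp add: sum.distrib sum_distrib_left[symmetric] sum_distrib_right[symmetric] sum_d' p1)
    also have "\<dots> = line y T" by (simp add: line_def algebra_simps)
    finally show ?thesis .
  qed
  have \<tau>d': "\<tau> \<le> d' i" for i by (simp add: d'_def)
  show ?thesis
  proof (cases "\<exists>j\<in>I. d j < \<tau>")
    case False
    then have e: "e i = 0" if "i \<in> I" for i using that by (force simp: e_def)
    then have "T = 0" by (simp add: T_def)
    \<comment> \<open>Nothing was clipped, so the mean is 0 and the tangent at 0, of value 1 there,
      suffices.\<close>
    have "gtilt \<alpha> (d i) \<le> line 0 (d' i)" if "i \<in> I" for i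
      using line[of 0 "d' i"] a \<tau>d'[of i] e[OF that] by (simp add: d'_eq)
    then have "(\<Sum>i\<in>I. p i * gtilt \<alpha> (d i)) \<le> (\<Sum>i\<in>I. p i * line 0 (d' i))"
      using p0 by (intro sum_mono mult_left_mono) auto
    also have "\<dots> = 1" by (simp add: sum_line \<open>T = 0\<close>) (simp add: line_def)
    finally show ?thesis .
  next
    case True
    then obtain j where j: "j \<in> I" "d j < \<tau>" by blast
    have pe_le: "p i * e i \<le> T" if "i \<in> I" for i
      unfolding T_def using that I p0 e0 by (intro member_le_sum) auto
    have "0 < p j * e j" using j p[of j] a by (intro mult_pos_pos) (auto simp: e_def)
    then have Tpos: "0 < T" using pe_le[OF j(1)] by simp
    \<comment> \<open>The displacement that a single atom of weight \<alpha> needs in order to carry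
      all of \<open>T\<close>; no \<open>e i\<close> exceeds it.\<close>
    define E where "E = T / \<alpha>"
    have Epos: "0 < E" using Tpos a by (simp add: E_def)
    have eE: "e i \<le> E" if "i \<in> I" for i
    proof -
      have "\<alpha> * e i \<le> p i * e i" using p[OF that] e0 by (intro mult_right_mono) auto
      with pe_le[OF that] a show ?thesis by (simp add: E_def field_simps)
    qed
    \<comment> \<open>By convexity below \<open>\<tau>\<close>, the sum is largest when the total displacement \<open>T\<close> is carried by a
       single atom of the smallest admissible weight \<open>\<alpha>\<close>.\<close>
    have split: "gtilt \<alpha> (d i) \<le> gtilt \<alpha> (d' i) + e i / E * (gtilt \<alpha> (\<tau> - E) - gtilt \<alpha> \<tau>)"
      if i: "i \<in> I" for i
    proof (cases "d i < \<tau>")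
      case True
      have "d i = (1 - e i / E) *\<^sub>R \<tau> + (e i / E) *\<^sub>R (\<tau> - E)"
        using True Epos by (simp add: e_def field_simps)
      then have "gtilt \<alpha> (d i) = gtilt \<alpha> ((1 - e i / E) *\<^sub>R \<tau> + (e i / E) *\<^sub>R (\<tau> - E))"
        by simp
      also have "\<dots> \<le> (1 - e i / E) * gtilt \<alpha> \<tau> + e i / E * gtilt \<alpha> (\<tau> - E)"
        using eE[OF i] e0[of i] Epos
        by (intro convex_onD[OF gtilt_convex[OF a(1)]]) (auto simp: \<tau>_def)
      finally show ?thesis using True by (simp add: d'_def algebra_simps)
    next
      case False
      then show ?thesis by (simp add: d'_def e_def)
    qed
    \<comment> \<open>\<open>- m\<close> is the position \<open>\<tau> - E\<close> of the atom of
      weight \<alpha>; \<open>yb\<close> is where the remaining mass must sit for the mean to be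
      0.\<close>
    define m where "m = E - \<tau>"
    define yb where "yb = \<alpha> * m / (1 - \<alpha>)"
    have yb0: "0 \<le> yb" using a \<tau>0 Epos by (simp add: yb_def m_def)
    have main: "(\<Sum>i\<in>I. p i * gtilt \<alpha> (d i)) \<le> \<alpha> * gtilt \<alpha> (- m) + (1 - \<alpha>) * line y yb"
      if y: "0 \<le> y" "y \<le> 2 * \<alpha>" for y
    proof -
      have "(\<Sum>i\<in>I. p i * gtilt \<alpha> (d i))
          \<le> (\<Sum>i\<in>I. p i * (gtilt \<alpha> (d' i) + e i / E * (gtilt \<alpha> (\<tau> - E) - gtilt \<alpha> \<tau>)))"
        using split p0 by (intro sum_mono mult_left_mono) auto
      also have "\<dots> = (\<Sum>i\<in>I. p i * gtilt \<alpha> (d' i) + p i * e i * ((gtilt \<alpha> (\<tau> - E) - gtilt \<alpha> \<tau>) / E))"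
        by (intro sum.cong refl) (simp add: distrib_left)
      also have "\<dots> = (\<Sum>i\<in>I. p i * gtilt \<alpha> (d' i)) + T * ((gtilt \<alpha> (\<tau> - E) - gtilt \<alpha> \<tau>) / E)"
        by (simp only: sum.distrib sum_distrib_right[symmetric] T_def)
      also have "T * ((gtilt \<alpha> (\<tau> - E) - gtilt \<alpha> \<tau>) / E) = \<alpha> * (gtilt \<alpha> (- m) - gtilt \<alpha> \<tau>)"
        using Tpos a by (simp add: E_def m_def)
      finally have 1: "(\<Sum>i\<in>I. p i * gtilt \<alpha> (d i)) \<le>
        (\<Sum>i\<in>I. p i * gtilt \<alpha> (d' i)) + \<alpha> * (gtilt \<alpha> (- m) - gtilt \<alpha> \<tau>)" .
      have nn: "0 \<le> p i * (line y (d' i) - gtilt \<alpha> (d' i))" if "i \<in> I" for i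
        using line[OF y \<tau>d'] p0[OF that] by simp
      \<comment> \<open>After clipping, point \<open>j\<close> sits at \<open>\<tau>\<close> with
        weight at least \<alpha>. The gap under the tangent there pays for taking weight \<alpha>
        away from \<open>\<tau>\<close>; that weight reappears at \<open>- m\<close>.\<close>
      have "\<alpha> * (line y \<tau> - gtilt \<alpha> \<tau>) \<le> p j * (line y (d' j) - gtilt \<alpha> (d' j))"
        using j p[OF j(1)] line[OF y, of \<tau>] by (simp add: d'_def mult_right_mono)
      also have "\<dots> \<le> (\<Sum>i\<in>I. p i * (line y (d' i) - gtilt \<alpha> (d' i)))"
        using j I nn by (intro member_le_sum[of j I "\<lambda>i. p i * (line y (d' i) - gtilt \<alpha> (d' i))"]) auto
      also have "\<dots> = line y T - (\<Sum>i\<in>I. p i * gtilt \<alpha> (d' i))"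
        by (simp add: right_diff_distrib sum_subtractf sum_line)
      finally have 2: "(\<Sum>i\<in>I. p i * gtilt \<alpha> (d' i)) \<le> line y T - \<alpha> * line y \<tau> + \<alpha> * gtilt \<alpha> \<tau>"
        by (simp add: algebra_simps)
      have "(1 - \<alpha>) * yb = T - \<alpha> * \<tau>"
        using a by (simp add: yb_def m_def E_def field_simps)
      then have "line y T - \<alpha> * line y \<tau> = (1 - \<alpha>) * line y yb"
        unfolding line_def by algebra
      with 1 2 show ?thesis by (simp add: algebra_simps)
    qed
    \<comment> \<open>The parameter of the two-point inequality; \<open>s \<le> 2\<close> says that
      \<open>yb\<close> has not passed the peak, so the tangent at \<open>yb\<close> is
      allowed.\<close>
    define s where "s = m / (1 - \<alpha>)"
    have m_s: "m = (1 - \<alpha>) * s" and yb_s: "yb = \<alpha> * s"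
      using a by (auto simp: s_def yb_def)
    have s0: "0 \<le> s" using a \<tau>0 Epos by (simp add: s_def m_def)
    show ?thesis
    proof (cases "s \<le> 2")
      case True
      have "(\<Sum>i\<in>I. p i * gtilt \<alpha> (d i)) \<le> \<alpha> * gtilt \<alpha> (- m) + (1 - \<alpha>) * line yb yb"
        using True yb0 a by (intro main) (auto simp: yb_s)
      also have "\<dots> = \<alpha> * gtilt \<alpha> (- (1 - \<alpha>) * s) + (1 - \<alpha>) * gtilt \<alpha> (\<alpha> * s)"
        by (simp only: line_def m_s yb_s minus_mult_left) simp
      also have "\<dots> \<le> 1" by (rule two_point_inequality[OF a s0 True])
      finally show ?thesis .
    next
      case False
      \<comment> \<open>Past the peak the horizontal tangent at \<open>2 * \<alpha>\<close> is used,
        and moving the left atom up to its position for \<open>s = 2\<close> only increases its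
        tilt.\<close>
      have "(\<Sum>i\<in>I. p i * gtilt \<alpha> (d i)) \<le> \<alpha> * gtilt \<alpha> (- m) + (1 - \<alpha>) * line (2 * \<alpha>) yb"
        using a by (intro main) auto
      also have "line (2 * \<alpha>) yb = gtilt \<alpha> (\<alpha> * 2)"
        using a by (simp add: line_def mult.commute)
      also have "gtilt \<alpha> (- m) \<le> gtilt \<alpha> (- (1 - \<alpha>) * 2)"
      proof (rule gtilt_mono[OF a(1)])
        have "(1 - \<alpha>) * 2 \<le> (1 - \<alpha>) * s" using False a by (intro mult_left_mono) auto
        then show "- m \<le> - (1 - \<alpha>) * 2" unfolding m_s by linarith
        show "- (1 - \<alpha>) * 2 \<le> 2 * \<alpha>" using a by simp
      qed
      also have "\<alpha> * gtilt \<alpha> (- (1 - \<alpha>) * 2) + (1 - \<alpha>) * gtilt \<alpha> (\<alpha> * 2) \<le> 1"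
        by (rule two_point_inequality[OF a]) auto
      finally show ?thesis using a by simp
    qed
  qed
qed

section \<open>Cubes and averages\<close>

locale homogeneous_filtration = prob_space M for M :: "'a measure" +
  fixes F D :: "nat \<Rightarrow> 'a set set" and \<alpha> :: real
  assumes filtration: "atomic_filtration M F D"
    and homogeneous: "homogeneous M D \<alpha>"
    and alpha_pos: "0 < \<alpha>"
begin

section \<open>Combinatorics of the cubes\<close>

lemma F_sigma: "sigma_algebra (space M) (F n)"
  and F_sets: "F n \<subseteq> sets M"
  using conjunct1[OF filtration[unfolded atomic_filtration_def]] by auto

lemma F_Suc: "F n \<subseteq> F (Suc n)"
  and F_0: "F 0 = {{}, space M}"
  and F_generate: "sets M = sigma_sets (space M) (\<Union>n. F n)"
  using conjunct2[OF filtration[unfolded atomic_filtration_def]] by meson+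

lemma D_disjoint: "disjoint (D n)"
  and D_F: "D n \<subseteq> F n"
  and F_Union: "A \<in> F n \<Longrightarrow> \<exists>C\<subseteq>D n. A = \<Union>C"
  using conjunct2[OF conjunct2[OF conjunct2[OF conjunct2[OF filtration[unfolded atomic_filtration_def]]]]]
  by meson+

lemma F_mono: "m \<le> n \<Longrightarrow> F m \<subseteq> F n"
  using F_Suc by (rule lift_Suc_mono_le)

lemma D_sets: "Q \<in> D n \<Longrightarrow> Q \<in> sets M"
  using D_F F_sets by blast

lemma D_unique: "Q \<in> D n \<Longrightarrow> R \<in> D n \<Longrightarrow> x \<in> Q \<Longrightarrow> x \<in> R \<Longrightarrow> Q = R"
  using D_disjoint[of n] unfolding disjoint_def by blast

text \<open>Cubes are the atoms of \<open>F n\<close>: \<open>A\<close> is a union of cubes, and by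
  disjointness the one containing \<open>x\<close> is \<open>R\<close>.\<close>

lemma D_subset_F: "R \<in> D n \<Longrightarrow> A \<in> F n \<Longrightarrow> x \<in> R \<Longrightarrow> x \<in> A \<Longrightarrow> R \<subseteq> A"
proof -
  assume R: "R \<in> D n" "x \<in> R" and "A \<in> F n" "x \<in> A"
  then obtain C where C: "C \<subseteq> D n" "A = \<Union>C" using F_Union by blast
  with \<open>x \<in> A\<close> obtain S where "S \<in> C" "x \<in> S" by blast
  with C R have "R = S" using D_unique[of R n S x] by blast
  with \<open>S \<in> C\<close> C show "R \<subseteq> A" by blast
qed

lemma D_cover: "\<Union>(D n) = space M"
proof
  show "\<Union>(D n) \<subseteq> space M" using D_sets sets.sets_into_space by blast
  have "space M \<in> F n"
    using F_sigma[of n] by (meson algebra.top sigma_algebra_def)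
  then show "space M \<subseteq> \<Union>(D n)" using F_Union[of "space M" n] by (metis Union_mono)
qed

lemma cube_obtain:
  assumes "x \<in> space M"
  obtains Q where "Q \<in> D n" "x \<in> Q"
  using assms D_cover[of n] by blast

lemma ch_cover:
  assumes "Q \<in> D n"
  shows "\<Union>(ch D n Q) = Q"
proof
  show "\<Union>(ch D n Q) \<subseteq> Q" by (auto simp: ch_def)
  have "Q \<in> F (Suc n)" using assms D_F F_Suc by blast
  then obtain C where "C \<subseteq> D (Suc n)" "Q = \<Union>C" using F_Union by blast
  then show "Q \<subseteq> \<Union>(ch D n Q)" by (auto simp: ch_def)
qed

lemma parent:
  assumes R: "R \<in> D (Suc n)" and x: "x \<in> R"
  obtains Q where "Q \<in> D n" "x \<in> Q" "R \<in> ch D n Q"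
proof -
  have "x \<in> space M" using R x D_sets sets.sets_into_space by blast
  then obtain Q where Q: "Q \<in> D n" "x \<in> Q" by (rule cube_obtain)
  have "Q \<in> F (Suc n)" using Q D_F F_Suc by blast
  then have "R \<subseteq> Q" using D_subset_F[OF R _ x Q(2)] by blast
  then show ?thesis using that[OF Q] R by (simp add: ch_def)
qed

text \<open>Descending from the whole space, of mass 1, each generation costs at most a factor
  \<alpha>.\<close>

lemma D_measure_ge: "Q \<in> D n \<Longrightarrow> Q \<noteq> {} \<Longrightarrow> \<alpha> ^ n \<le> measure M Q"
proof (induction n arbitrary: Q)
  case 0
  then have "Q = space M" using D_F[of 0] F_0 by auto
  then show ?case by (simp add: prob_space)
next
  case (Suc n)
  then obtain x where x: "x \<in> Q" by blast
  obtain P where P: "P \<in> D n" "x \<in> P" "Q \<in> ch D n P"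
    using parent[OF Suc.prems(1) x] by blast
  have "\<alpha> * \<alpha> ^ n \<le> \<alpha> * measure M P"
    using Suc.IH[OF P(1)] P(2) alpha_pos by auto
  also have "\<dots> \<le> measure M Q"
    using homogeneous P unfolding homogeneous_def by blast
  finally show ?case by simp
qed

lemma D_measure_pos: "Q \<in> D n \<Longrightarrow> Q \<noteq> {} \<Longrightarrow> 0 < measure M Q"
  using D_measure_ge[of Q n] alpha_pos by (meson less_le_trans zero_less_power)

text \<open>The empty set would be a child of a cube of positive measure, against homogeneity.
  Generation 0 may contain it, whence the cases \<open>Q = {}\<close> below.\<close>

lemma empty_notin_D_Suc: "{} \<notin> D (Suc n)"
proof
  assume *: "{} \<in> D (Suc n)"
  obtain x where "x \<in> space M" using not_empty by blast
  then obtain Q where Q: "Q \<in> D n" "x \<in> Q" by (rule cube_obtain)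
  have "\<alpha> * measure M Q \<le> measure M {}"
    using homogeneous Q * unfolding homogeneous_def ch_def by blast
  moreover have "0 < \<alpha> * measure M Q"
    using alpha_pos D_measure_pos[OF Q(1)] Q(2) by (intro mult_pos_pos) auto
  ultimately show False by simp
qed

lemma disjoint_family_cubes: "C \<subseteq> D n \<Longrightarrow> disjoint_family_on (\<lambda>Q. Q) C"
  using D_disjoint[of n] unfolding disjoint_family_on_def disjoint_def by blast

text \<open>Disjoint cubes of mass at least \<open>\<alpha> ^ n\<close> fit at most
  \<open>1 / \<alpha> ^ n\<close> times into total mass 1. The sums over cubes in the definitions
  thus become finite sums.\<close>

lemma finite_D [simp]: "finite (D n)"
proof -
  have "finite (D n - {{}}) \<and> card (D n - {{}}) \<le> nat \<lceil>1 / \<alpha> ^ n\<rceil>"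
  proof (rule finite_if_finite_subsets_card_bdd)
    fix G assume G: "G \<subseteq> D n - {{}}" "finite G"
    have "real (card G) * \<alpha> ^ n = (\<Sum>Q\<in>G. \<alpha> ^ n)" by simp
    also have "\<dots> \<le> (\<Sum>Q\<in>G. measure M Q)"
      using G D_measure_ge by (intro sum_mono) blast
    also have "\<dots> = measure M (\<Union>Q\<in>G. Q)"
      using G D_sets by (intro finite_measure_finite_Union[symmetric] disjoint_family_cubes) auto
    also have "\<dots> \<le> 1" by simp
    finally have "real (card G) \<le> 1 / \<alpha> ^ n"
      using alpha_pos by (simp add: field_simps)
    then show "card G \<le> nat \<lceil>1 / \<alpha> ^ n\<rceil>" by linarith
  qed
  then show ?thesis by simp
qed

lemma finite_ch [simp]: "finite (ch D n Q)"
  by (rule finite_subset[OF _ finite_D[of "Suc n"]]) (auto simp: ch_def)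

section \<open>Conditional expectations and functions constant on cubes\<close>

text \<open>For integrable \<open>f\<close> this is the conditional expectation given
  \<open>F n\<close>.\<close>

definition cexp :: "nat \<Rightarrow> ('a \<Rightarrow> real) \<Rightarrow> 'a \<Rightarrow> real" where
  "cexp n f x = (\<Sum>Q\<in>D n. condE M Q f x)"

lemma sum_condE:
  assumes "C \<subseteq> D n" "R \<in> C" "x \<in> R"
  shows "(\<Sum>Q\<in>C. condE M Q f x) = avg M f R"
proof -
  have "finite C" using assms(1) finite_D by (rule finite_subset)
  have "(\<Sum>Q\<in>C. condE M Q f x) = (\<Sum>Q\<in>C. if Q = R then avg M f R else 0)"
    using assms D_unique[of _ n R x] by (intro sum.cong refl) (auto simp: condE_def indicator_def)
  then show ?thesis using assms \<open>finite C\<close> by simp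
qed

lemma cexp_cube: "Q \<in> D n \<Longrightarrow> x \<in> Q \<Longrightarrow> cexp n f x = avg M f Q"
  unfolding cexp_def by (rule sum_condE) auto

lemma mdiff_cube:
  assumes Q: "Q \<in> D n" and x: "x \<in> Q"
  shows "mdiff M D n Q f x = cexp (Suc n) f x - cexp n f x"
proof -
  obtain R where R: "R \<in> ch D n Q" "x \<in> R" using ch_cover[OF Q] x by blast
  have "(\<Sum>R\<in>ch D n Q. condE M R f x) = avg M f R"
    using R by (intro sum_condE[of _ "Suc n"]) (auto simp: ch_def)
  also have "\<dots> = cexp (Suc n) f x"
    using R by (intro cexp_cube[symmetric]) (auto simp: ch_def)
  finally show ?thesis
    using x cexp_cube[OF Q x] by (simp add: mdiff_def condE_def)
qed

lemma mdiff_outside: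
  assumes "x \<notin> Q"
  shows "mdiff M D n Q f x = 0"
proof -
  have "condE M R f x = 0" if "R \<in> ch D n Q" for R
    using that assms by (auto simp: condE_def ch_def indicator_def)
  then show ?thesis using assms by (simp add: mdiff_def) (simp add: condE_def)
qed

text \<open>In each generation exactly one cube contains \<open>x\<close>, so only one term of the
  inner sum survives: the squared martingale increment.\<close>

lemma sq_sum_eq:
  assumes "x \<in> space M"
  shows "sq_sum M D f x = (\<Sum>n. ennreal ((cexp (Suc n) f x - cexp n f x)\<^sup>2))"
  unfolding sq_sum_def
proof (rule suminf_cong)
  fix n
  obtain Q where Q: "Q \<in> D n" "x \<in> Q" using assms by (rule cube_obtain)
  have "(\<Sum>R\<in>D n. ennreal ((mdiff M D n R f x)\<^sup>2)) =
      (\<Sum>R\<in>D n. if R = Q then ennreal ((cexp (Suc n) f x - cexp n f x)\<^sup>2) else 0)"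
  proof (rule sum.cong[OF refl])
    fix R assume R: "R \<in> D n"
    show "ennreal ((mdiff M D n R f x)\<^sup>2) =
      (if R = Q then ennreal ((cexp (Suc n) f x - cexp n f x)\<^sup>2) else 0)"
    proof (cases "R = Q")
      case True
      then show ?thesis using mdiff_cube[OF Q, of f] by simp
    next
      case False
      then have "x \<notin> R" using D_unique[OF R Q(1) _ Q(2)] by blast
      then show ?thesis using False mdiff_outside[of x R n f] by simp
    qed
  qed
  then show "(\<Sum>\<^sub>\<infinity>R\<in>D n. ennreal ((mdiff M D n R f x)\<^sup>2)) = ennreal ((cexp (Suc n) f x - cexp n f x)\<^sup>2)"
    using Q by simp
qed

text \<open>Stands in for measurability with respect to \<open>F n\<close>; integrals of such
  functions are finite sums.\<close>

definition cubewise :: "nat \<Rightarrow> ('a \<Rightarrow> real) \<Rightarrow> bool" where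
  "cubewise n h \<longleftrightarrow> (\<forall>Q\<in>D n. \<forall>x\<in>Q. \<forall>y\<in>Q. h x = h y)"

text \<open>For the empty cube the value is arbitrary, and is always multiplied by a vanishing
  indicator or measure.\<close>

definition pt :: "'a set \<Rightarrow> 'a" where
  "pt Q = (SOME x. x \<in> Q)"

lemma pt_in: "Q \<noteq> {} \<Longrightarrow> pt Q \<in> Q"
  unfolding pt_def by (rule someI_ex) blast

lemma cubewise_pt: "cubewise n h \<Longrightarrow> Q \<in> D n \<Longrightarrow> x \<in> Q \<Longrightarrow> h x = h (pt Q)"
  using pt_in[of Q] unfolding cubewise_def by blast

lemma cubewise_eq_sum:
  assumes h: "cubewise n h" and x: "x \<in> space M"
  shows "h x = (\<Sum>Q\<in>D n. h (pt Q) * indicator Q x)"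
proof -
  obtain Q where Q: "Q \<in> D n" "x \<in> Q" using x by (rule cube_obtain)
  have "(\<Sum>R\<in>D n. h (pt R) * indicator R x) = (\<Sum>R\<in>D n. if R = Q then h x else 0)"
  proof (rule sum.cong[OF refl])
    fix R assume R: "R \<in> D n"
    show "h (pt R) * indicator R x = (if R = Q then h x else 0)"
    proof (cases "R = Q")
      case True
      then show ?thesis using cubewise_pt[OF h Q] Q(2) by simp
    next
      case False
      then have "x \<notin> R" using D_unique[OF R Q(1) _ Q(2)] by blast
      then show ?thesis using False by simp
    qed
  qed
  then show ?thesis using Q by simp
qed

lemma integrable_cubewise:
  assumes "cubewise n h"
  shows "integrable M h"
    and integral_cubewise: "(\<integral>x. h x \<partial>M) = (\<Sum>Q\<in>D n. h (pt Q) * measure M Q)"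
proof -
  let ?g = "\<lambda>x. \<Sum>Q\<in>D n. h (pt Q) * indicator Q x"
  have int: "integrable M (indicator Q :: 'a \<Rightarrow> real)" if "Q \<in> D n" for Q
    using D_sets[OF that] by (simp add: integrable_indicator_iff less_top[symmetric])
  have g: "integrable M ?g"
    using int by (intro Bochner_Integration.integrable_sum integrable_mult_right) auto
  then show "integrable M h"
    using Bochner_Integration.integrable_cong[of M M h ?g] cubewise_eq_sum[OF assms] by simp
  have "(\<integral>x. h x \<partial>M) = (\<integral>x. ?g x \<partial>M)"
    using cubewise_eq_sum[OF assms] by (intro Bochner_Integration.integral_cong) auto
  also have "\<dots> = (\<Sum>Q\<in>D n. h (pt Q) * measure M Q)"
    using int D_sets sets.sets_into_space
    by (subst Bochner_Integration.integral_sum) (auto intro!: sum.cong simp: Int_absorb2)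
  finally show "(\<integral>x. h x \<partial>M) = (\<Sum>Q\<in>D n. h (pt Q) * measure M Q)" .
qed

lemma cubewise_Suc:
  assumes "cubewise n h"
  shows "cubewise (Suc n) h"
  unfolding cubewise_def
proof (intro ballI)
  fix R x y assume R: "R \<in> D (Suc n)" "x \<in> R" "y \<in> R"
  obtain Q where "Q \<in> D n" "x \<in> Q" "R \<in> ch D n Q" using parent[OF R(1,2)] .
  then show "h x = h y" using assms R(3) unfolding cubewise_def ch_def by blast
qed

lemma cubewise_cexp: "cubewise n (cexp n f)"
  unfolding cubewise_def using cexp_cube by simp

lemma cubewise_cexp_le: "k \<le> n \<Longrightarrow> cubewise n (cexp k f)"
  by (induction rule: dec_induct) (auto intro: cubewise_cexp cubewise_Suc)

lemma integrable_cexp: "integrable M (cexp n f)"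
  by (rule integrable_cubewise[OF cubewise_cexp])

lemma avg_mult_measure:
  assumes "Q \<in> D n"
  shows "avg M f Q * measure M Q = (LINT x:Q|M. f x)"
proof (cases "Q = {}")
  case False
  then show ?thesis using D_measure_pos[OF assms] by (simp add: avg_def)
qed (simp add: set_lebesgue_integral_def)

lemma set_integrable_cube: "integrable M f \<Longrightarrow> Q \<in> D n \<Longrightarrow> set_integrable M Q (f :: 'a \<Rightarrow> real)"
  using D_sets unfolding set_integrable_def by (intro integrable_mult_indicator) auto

lemma set_integral_cubes:
  assumes "integrable M (f :: 'a \<Rightarrow> real)" "C \<subseteq> D n"
  shows "(LINT x:\<Union>C|M. f x) = (\<Sum>Q\<in>C. LINT x:Q|M. f x)"
  using set_integral_finite_Union[of C "\<lambda>Q. Q" M f] assms finite_subset[OF assms(2) finite_D]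
    disjoint_family_cubes[OF assms(2)] set_integrable_cube[of f _ n] D_sets[of _ n]
  by (simp add: subset_iff)

lemma integral_eq_sum_cubes:
  assumes "integrable M (f :: 'a \<Rightarrow> real)"
  shows "(\<integral>x. f x \<partial>M) = (\<Sum>Q\<in>D n. LINT x:Q|M. f x)"
  using set_integral_cubes[OF assms order_refl, of n] set_integral_space[OF assms]
  by (simp add: D_cover)

text \<open>The martingale property on one cube.\<close>

lemma sum_children_avg:
  assumes "integrable M f" "Q \<in> D n"
  shows "(\<Sum>R\<in>ch D n Q. measure M R * avg M f R) = measure M Q * avg M f Q"
proof -
  have sub: "ch D n Q \<subseteq> D (Suc n)" by (auto simp: ch_def)
  have "(\<Sum>R\<in>ch D n Q. measure M R * avg M f R) = (\<Sum>R\<in>ch D n Q. LINT x:R|M. f x)"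
    using sub by (intro sum.cong refl) (auto simp: avg_mult_measure[symmetric])
  also have "\<dots> = measure M Q * avg M f Q"
    using set_integral_cubes[OF assms(1) sub] avg_mult_measure[OF assms(2), of f]
    by (simp add: ch_cover[OF assms(2)] mult.commute)
  finally show ?thesis .
qed

lemma sum_children_measure:
  assumes "Q \<in> D n"
  shows "(\<Sum>R\<in>ch D n Q. measure M R) = measure M Q"
proof -
  have sub: "ch D n Q \<subseteq> D (Suc n)" by (auto simp: ch_def)
  have "(\<Sum>R\<in>ch D n Q. measure M R) = measure M (\<Union>R\<in>ch D n Q. R)"
    using sub D_sets by (intro finite_measure_finite_Union[symmetric] disjoint_family_cubes[OF sub]) auto
  then show ?thesis using ch_cover[OF assms] by simp
qed

lemma cexp_add:
  assumes "integrable M f" "integrable M g"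
  shows "cexp n (\<lambda>x. f x + g x) x = cexp n f x + cexp n g x"
proof -
  have "condE M Q (\<lambda>x. f x + g x) x = condE M Q f x + condE M Q g x" if "Q \<in> D n" for Q
    using set_integral_add(2)[OF set_integrable_cube[OF assms(1) that] set_integrable_cube[OF assms(2) that]]
    by (simp add: condE_def avg_def add_divide_distrib distrib_right)
  then show ?thesis by (simp add: cexp_def sum.distrib)
qed

lemma cexp_mult:
  "cexp n (\<lambda>x. c * f x) x = c * cexp n f x"
  unfolding cexp_def condE_def avg_def by (simp add: sum_distrib_left mult.assoc)

lemma cexp_diff:
  assumes "integrable M f" "integrable M g"
  shows "cexp n (\<lambda>x. f x - g x) x = cexp n f x - cexp n g x"
  using cexp_add[of f "\<lambda>x. - 1 * g x" n x] cexp_mult[of n "- 1" g x] assms by simp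

text \<open>The triangle inequality for the integral over each cube, summed over the cubes.\<close>

lemma cexp_contraction:
  assumes f: "integrable M f"
  shows "(\<integral>x. \<bar>cexp n f x\<bar> \<partial>M) \<le> (\<integral>x. \<bar>f x\<bar> \<partial>M)"
proof -
  have cw: "cubewise n (\<lambda>x. \<bar>cexp n f x\<bar>)"
    using cubewise_cexp[of n f] unfolding cubewise_def by metis
  have "(\<integral>x. \<bar>cexp n f x\<bar> \<partial>M) = (\<Sum>Q\<in>D n. \<bar>cexp n f (pt Q)\<bar> * measure M Q)"
    by (rule integral_cubewise[OF cw])
  also have "\<dots> \<le> (\<Sum>Q\<in>D n. LINT x:Q|M. \<bar>f x\<bar>)"
  proof (rule sum_mono)
    fix Q assume Q: "Q \<in> D n"
    show "\<bar>cexp n f (pt Q)\<bar> * measure M Q \<le> (LINT x:Q|M. \<bar>f x\<bar>)"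
    proof (cases "Q = {}")
      case False
      have "\<bar>cexp n f (pt Q)\<bar> * measure M Q = \<bar>avg M f Q * measure M Q\<bar>"
        using cexp_cube[OF Q pt_in[OF False]] by (simp add: abs_mult)
      also have "\<dots> \<le> (LINT x:Q|M. \<bar>f x\<bar>)"
        using set_integral_norm_bound[OF set_integrable_cube[OF f Q]]
        by (simp add: avg_mult_measure[OF Q])
      finally show ?thesis .
    qed (simp add: set_lebesgue_integral_def)
  qed
  also have "\<dots> = (\<integral>x. \<bar>f x\<bar> \<partial>M)"
    using f by (intro integral_eq_sum_cubes[symmetric]) simp
  finally show ?thesis .
qed

lemma cexp_cubewise:
  assumes h: "cubewise n h" and x: "x \<in> space M"
  shows "cexp n h x = h x"
proof -
  obtain Q where Q: "Q \<in> D n" "x \<in> Q" using x by (rule cube_obtain)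
  have "(LINT y:Q|M. h y) = (LINT y:Q|M. h x)"
    using D_sets[OF Q(1)]
  proof (rule set_lebesgue_integral_cong)
    show "\<forall>y. y \<in> Q \<longrightarrow> h y = h x" using h Q unfolding cubewise_def by blast
  qed
  also have "\<dots> = measure M Q * h x"
    using sets.sets_into_space[OF D_sets[OF Q(1)]] by (simp add: set_lebesgue_integral_def Int_absorb2)
  finally have "(LINT y:Q|M. h y) = measure M Q * h x" .
  moreover have "measure M Q \<noteq> 0" using D_measure_pos[OF Q(1)] Q(2) by fastforce
  ultimately show ?thesis by (simp add: cexp_cube[OF Q] avg_def)
qed

section \<open>Convergence of the averages\<close>

text \<open>The class of functions recovered in L1 from their averages, to be enlarged step by step
  to all integrable functions.\<close>

definition L1_approx :: "('a \<Rightarrow> real) \<Rightarrow> bool" where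
  "L1_approx f \<longleftrightarrow> (\<lambda>n. \<integral>x. \<bar>cexp n f x - f x\<bar> \<partial>M) \<longlonglongrightarrow> 0"

text \<open>Split \<open>cexp n f - f\<close> through \<open>s k\<close>; by contraction the
  averaging error of \<open>f - s k\<close> is no larger than its norm, uniformly in
  \<open>n\<close>.\<close>

lemma L1_approx_closed:
  assumes f: "integrable M f" and s: "\<And>k::nat. integrable M (s k)" "\<And>k. L1_approx (s k)"
    and lim: "(\<lambda>k. \<integral>x. \<bar>f x - s k x\<bar> \<partial>M) \<longlonglongrightarrow> 0"
  shows "L1_approx f"
  unfolding L1_approx_def
proof (rule LIMSEQ_I)
  fix e :: real assume e: "0 < e"
  then obtain k where k: "(\<integral>x. \<bar>f x - s k x\<bar> \<partial>M) < e / 4"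
    using order_tendstoD(2)[OF lim, of "e / 4"] by (auto simp: eventually_sequentially)
  obtain N where N: "\<And>n. n \<ge> N \<Longrightarrow> (\<integral>x. \<bar>cexp n (s k) x - s k x\<bar> \<partial>M) < e / 4"
    using order_tendstoD(2)[OF s(2)[of k, unfolded L1_approx_def], of "e / 4"] e
    by (auto simp: eventually_sequentially)
  note [simp] = f s(1) integrable_cexp
  have "norm ((\<integral>x. \<bar>cexp n f x - f x\<bar> \<partial>M) - 0) < e" if "n \<ge> N" for n
  proof -
    have "(\<integral>x. \<bar>cexp n f x - f x\<bar> \<partial>M) \<le>
        (\<integral>x. \<bar>cexp n (\<lambda>x. f x - s k x) x\<bar> + \<bar>cexp n (s k) x - s k x\<bar> + \<bar>f x - s k x\<bar> \<partial>M)"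
      by (intro integral_mono) (auto simp: cexp_diff)
    also have "\<dots> = (\<integral>x. \<bar>cexp n (\<lambda>x. f x - s k x) x\<bar> \<partial>M) + (\<integral>x. \<bar>cexp n (s k) x - s k x\<bar> \<partial>M)
        + (\<integral>x. \<bar>f x - s k x\<bar> \<partial>M)"
      by simp
    also have "(\<integral>x. \<bar>cexp n (\<lambda>x. f x - s k x) x\<bar> \<partial>M) \<le> (\<integral>x. \<bar>f x - s k x\<bar> \<partial>M)"
      by (intro cexp_contraction) simp
    finally have "(\<integral>x. \<bar>cexp n f x - f x\<bar> \<partial>M) < e"
      using k N[OF that] e by linarith
    then show ?thesis by simp
  qed
  then show "\<exists>N. \<forall>n\<ge>N. norm ((\<integral>x. \<bar>cexp n f x - f x\<bar> \<partial>M) - 0) < e" by blast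
qed

text \<open>Dominated convergence. The factor 2 is the bound supplied by the induction rule for
  integrable functions.\<close>

lemma L1_approx_pointwise_limit:
  assumes f: "integrable M f" and s: "\<And>k::nat. integrable M (s k)" "\<And>k. L1_approx (s k)"
    and lim: "\<And>x. x \<in> space M \<Longrightarrow> (\<lambda>k. s k x) \<longlonglongrightarrow> f x"
    and bound: "\<And>k x. x \<in> space M \<Longrightarrow> \<bar>s k x\<bar> \<le> 2 * \<bar>f x\<bar>"
  shows "L1_approx f"
proof (rule L1_approx_closed[OF f s])
  have "(\<lambda>k. \<integral>x. \<bar>f x - s k x\<bar> \<partial>M) \<longlonglongrightarrow> (\<integral>x. 0 \<partial>M)"
  proof (rule integral_dominated_convergence[where w = "\<lambda>x. 3 * \<bar>f x\<bar>"])
    show "AE x in M. (\<lambda>k. \<bar>f x - s k x\<bar>) \<longlonglongrightarrow> 0"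
    proof (rule AE_I2)
      fix x assume "x \<in> space M"
      then have "(\<lambda>k. \<bar>f x - s k x\<bar>) \<longlonglongrightarrow> \<bar>f x - f x\<bar>" by (intro tendsto_intros lim)
      then show "(\<lambda>k. \<bar>f x - s k x\<bar>) \<longlonglongrightarrow> 0" by simp
    qed
    show "AE x in M. norm \<bar>f x - s k x\<bar> \<le> 3 * \<bar>f x\<bar>" for k
    proof (rule AE_I2)
      fix x assume "x \<in> space M"
      then show "norm \<bar>f x - s k x\<bar> \<le> 3 * \<bar>f x\<bar>" using bound[of x k] by simp
    qed
  qed (use f s in auto)
  then show "(\<lambda>k. \<integral>x. \<bar>f x - s k x\<bar> \<partial>M) \<longlonglongrightarrow> 0" by simp
qed

lemma L1_approx_add:
  assumes [simp]: "integrable M f" "integrable M g" and fg: "L1_approx f" "L1_approx g"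
  shows "L1_approx (\<lambda>x. f x + g x)"
  unfolding L1_approx_def
proof (rule tendsto_sandwich[where f = "\<lambda>_. 0"])
  note [simp] = integrable_cexp
  show "(\<lambda>n. (\<integral>x. \<bar>cexp n f x - f x\<bar> \<partial>M) + (\<integral>x. \<bar>cexp n g x - g x\<bar> \<partial>M)) \<longlonglongrightarrow> 0"
    using tendsto_add[OF fg[unfolded L1_approx_def]] by simp
  have "(\<integral>x. \<bar>cexp n (\<lambda>x. f x + g x) x - (f x + g x)\<bar> \<partial>M) \<le>
     (\<integral>x. \<bar>cexp n f x - f x\<bar> + \<bar>cexp n g x - g x\<bar> \<partial>M)" for n
    by (intro integral_mono) (auto simp: cexp_add)
  then show "\<forall>\<^sub>F n in sequentially. (\<integral>x. \<bar>cexp n (\<lambda>x. f x + g x) x - (f x + g x)\<bar> \<partial>M) \<le>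
     (\<integral>x. \<bar>cexp n f x - f x\<bar> \<partial>M) + (\<integral>x. \<bar>cexp n g x - g x\<bar> \<partial>M)"
    by simp
qed auto

lemma L1_approx_mult:
  assumes "L1_approx f"
  shows "L1_approx (\<lambda>x. c * f x)"
proof -
  have "(\<integral>x. \<bar>cexp n (\<lambda>x. c * f x) x - c * f x\<bar> \<partial>M) = \<bar>c\<bar> * (\<integral>x. \<bar>cexp n f x - f x\<bar> \<partial>M)" for n
    by (simp add: cexp_mult right_diff_distrib[symmetric] abs_mult)
  then show ?thesis
    using tendsto_mult_right_zero[OF assms[unfolded L1_approx_def], of "\<bar>c\<bar>"] by (simp add: L1_approx_def)
qed

lemma L1_approx_cubewise:
  assumes "cubewise m h"
  shows "L1_approx h"
  unfolding L1_approx_def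
proof (rule tendsto_eventually, rule eventually_sequentiallyI)
  fix n assume "m \<le> n"
  then have "cubewise n h" using assms by (induction rule: dec_induct) (auto intro: cubewise_Suc)
  then have "(\<integral>x. \<bar>cexp n h x - h x\<bar> \<partial>M) = (\<integral>x. 0 \<partial>M)"
    by (intro Bochner_Integration.integral_cong) (auto simp: cexp_cubewise)
  then show "(\<integral>x. \<bar>cexp n h x - h x\<bar> \<partial>M) = 0" by simp
qed

text \<open>A Dynkin argument: the union of the increasing \<open>F n\<close> is stable under
  intersection and generates, and the class admits complements and disjoint unions.\<close>

lemma L1_approx_indicator:
  assumes "A \<in> sets M"
  shows "L1_approx (indicator A)"
proof -
  have int: "integrable M (indicator A :: 'a \<Rightarrow> real)" if "A \<in> sets M" for A
    using that by (simp add: integrable_indicator_iff less_top[symmetric])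
  have stable: "Int_stable (\<Union>n. F n)"
  proof (rule Int_stableI)
    fix A B assume "A \<in> (\<Union>n. F n)" "B \<in> (\<Union>n. F n)"
    then obtain m n where "A \<in> F m" "B \<in> F n" by blast
    then have "A \<in> F (max m n)" "B \<in> F (max m n)"
      using F_mono[of m "max m n"] F_mono[of n "max m n"] by auto
    moreover have "algebra (space M) (F (max m n))"
      using F_sigma sigma_algebra_def by blast
    ultimately show "A \<inter> B \<in> (\<Union>n. F n)"
      by (meson UNIV_I UN_I algebra_iff_Int)
  qed
  have sub: "(\<Union>n. F n) \<subseteq> Pow (space M)"
    using F_sets sets.sets_into_space by blast
  have cw: "cubewise n (indicator A)" if "A \<in> F n" for A n
    using D_subset_F[OF _ that] unfolding cubewise_def by (force simp: indicator_def)
  have "A \<in> sigma_sets (space M) (\<Union>n. F n)" using assms F_generate by simp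
  from stable sub this show ?thesis
  proof (induction rule: sigma_sets_induct_disjoint)
    case (basic A)
    then show ?case using cw L1_approx_cubewise by blast
  next
    case empty
    have "{} \<in> F 0" by (simp add: F_0)
    then show ?case using cw L1_approx_cubewise by blast
  next
    case (compl A)
    then have A: "A \<in> sets M" by (simp add: F_generate)
    have "space M \<in> F 0" by (simp add: F_0)
    then have "L1_approx (indicator (space M))" using cw L1_approx_cubewise by blast
    then have "L1_approx (\<lambda>x. indicator (space M) x + - 1 * indicator A x)"
      using A compl by (intro L1_approx_add L1_approx_mult) (auto intro: int)
    also have "(\<lambda>x. indicator (space M) x + - 1 * indicator A x) = (indicator (space M - A) :: 'a \<Rightarrow> real)"
      using sets.sets_into_space[OF A] by (auto simp: indicator_def fun_eq_iff)
    finally show ?case .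
  next
    case (union A)
    then have A: "A i \<in> sets M" for i by (auto simp: F_generate)
    \<comment> \<open>Finite unions follow by additivity; the countable union is their pointwise
      limit.\<close>
    have fin: "L1_approx (indicator (\<Union>i<k. A i))" for k
    proof (induction k)
      case 0
      have "{} \<in> F 0" by (simp add: F_0)
      then have "L1_approx (indicator {})" using cw L1_approx_cubewise by blast
      moreover have "(\<Union>i<0. A i) = {}" by simp
      ultimately show ?case by (simp only:)
    next
      case (Suc k)
      have "L1_approx (\<lambda>x. indicator (\<Union>i<k. A i) x + indicator (A k) x)"
        using Suc union A by (intro L1_approx_add) (auto intro!: int)
      also have "(\<lambda>x. indicator (\<Union>i<k. A i) x + indicator (A k) x) = (indicator (\<Union>i<Suc k. A i) :: 'a \<Rightarrow> real)"
      proof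
        fix x
        have "A i \<inter> A k = {}" if "i < k" for i
          using disjoint_family_onD[OF union(1), of i k] that by simp
        then have "(\<Union>i<k. A i) \<inter> A k = {}" by blast
        then show "indicator (\<Union>i<k. A i) x + indicator (A k) x = (indicator (\<Union>i<Suc k. A i) x :: real)"
          by (auto simp: indicator_def lessThan_Suc)
      qed
      finally show ?case .
    qed
    show ?case
    proof (rule L1_approx_pointwise_limit[where s = "\<lambda>k. indicator (\<Union>i<k. A i)"])
      show "(\<lambda>k. indicator (\<Union>i<k. A i) x :: real) \<longlonglongrightarrow> indicator (\<Union>i. A i) x" for x
        by (rule LIMSEQ_indicator_UN)
      show "\<bar>indicator (\<Union>i<k. A i) x :: real\<bar> \<le> 2 * \<bar>indicator (\<Union>i. A i) x\<bar>" for k x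
        by (auto simp: indicator_def)
    qed (use fin A in \<open>auto intro!: int\<close>)
  qed
qed

lemma cexp_tendsto_L1:
  assumes "integrable M f"
  shows "(\<lambda>n. \<integral>x. \<bar>cexp n f x - f x\<bar> \<partial>M) \<longlonglongrightarrow> 0"
proof -
  from assms have "L1_approx f"
  proof (induction rule: integrable_induct)
    case (base A c)
    then show ?case
      using L1_approx_mult[OF L1_approx_indicator, of A c] by (simp add: mult.commute)
  next
    case (add f g)
    then show ?case by (intro L1_approx_add)
  next
    case (lim f s)
    then show ?case by (intro L1_approx_pointwise_limit[of f s]) auto
  qed
  then show ?thesis by (simp add: L1_approx_def)
qed

section \<open>The exponential supermartingale\<close>

definition expmart :: "real \<Rightarrow> ('a \<Rightarrow> real) \<Rightarrow> nat \<Rightarrow> 'a \<Rightarrow> real" where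
  "expmart t f n x = exp (t * (cexp n f x - cexp 0 f x)
     - t\<^sup>2 / (4 * \<alpha>) * (\<Sum>k<n. (cexp (Suc k) f x - cexp k f x)\<^sup>2))"

text \<open>Scaling the increment by \<open>t\<close> makes the new quadratic term exactly that of
  the tilt.\<close>

lemma expmart_Suc:
  "expmart t f (Suc n) x = expmart t f n x * gtilt \<alpha> (t * (cexp (Suc n) f x - cexp n f x))"
proof -
  define d where "d = cexp (Suc n) f x - cexp n f x"
  have "cexp (Suc n) f x = cexp n f x + d" by (simp add: d_def)
  then show ?thesis
    unfolding expmart_def gtilt_def exp_add[symmetric]
    by (simp add: algebra_simps add_divide_distrib)
qed

lemma cubewise_expmart: "cubewise n (expmart t f n)"
  unfolding cubewise_def
proof (intro ballI)
  fix Q x y assume Q: "Q \<in> D n" "x \<in> Q" "y \<in> Q"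
  have *: "cexp k f x = cexp k f y" if "k \<le> n" for k
    using cubewise_cexp_le[OF that, of f] Q unfolding cubewise_def by blast
  have "(\<Sum>k<n. (cexp (Suc k) f x - cexp k f x)\<^sup>2) = (\<Sum>k<n. (cexp (Suc k) f y - cexp k f y)\<^sup>2)"
    by (intro sum.cong refl) (simp add: * )
  then show "expmart t f n x = expmart t f n y"
    using *[of n] *[of 0] by (simp add: expmart_def)
qed

text \<open>The one-step inequality with relative masses as weights: homogeneity bounds them below,
  and the martingale property centres the increments.\<close>

lemma sum_children_gtilt:
  assumes a: "\<alpha> \<le> 1/2" and f: "integrable M f" and Q: "Q \<in> D n" "Q \<noteq> {}"
  shows "(\<Sum>R\<in>ch D n Q. measure M R * gtilt \<alpha> (t * (avg M f R - avg M f Q))) \<le> measure M Q"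
proof -
  define q where "q = measure M Q"
  have q: "0 < q" unfolding q_def by (rule D_measure_pos[OF Q])
  have "(\<Sum>R\<in>ch D n Q. measure M R / q * gtilt \<alpha> (t * (avg M f R - avg M f Q))) \<le> 1"
  proof (rule gtilt_centered_sum_le_one[OF alpha_pos a finite_ch])
    show "\<alpha> \<le> measure M R / q" if "R \<in> ch D n Q" for R
      using homogeneous Q(1) that q unfolding homogeneous_def q_def by (simp add: pos_le_divide_eq)
    show "(\<Sum>R\<in>ch D n Q. measure M R / q) = 1"
      using sum_children_measure[OF Q(1)] q by (simp add: sum_divide_distrib[symmetric] q_def)
    have "(\<Sum>R\<in>ch D n Q. measure M R / q * (t * (avg M f R - avg M f Q))) =
       (\<Sum>R\<in>ch D n Q. t / q * (measure M R * avg M f R - measure M R * avg M f Q))"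
      by (intro sum.cong refl) (use q in \<open>simp add: field_simps\<close>)
    also have "\<dots> = t / q * ((\<Sum>R\<in>ch D n Q. measure M R * avg M f R) - (\<Sum>R\<in>ch D n Q. measure M R) * avg M f Q)"
      by (simp only: sum_distrib_left[symmetric] sum_subtractf sum_distrib_right[symmetric])
    also have "\<dots> = 0"
      using sum_children_measure[OF Q(1)] sum_children_avg[OF f Q(1)] by simp
    finally show "(\<Sum>R\<in>ch D n Q. measure M R / q * (t * (avg M f R - avg M f Q))) = 0" .
  qed
  then have "(\<Sum>R\<in>ch D n Q. measure M R * gtilt \<alpha> (t * (avg M f R - avg M f Q))) / q \<le> 1"
    by (simp add: sum_divide_distrib)
  then show ?thesis using q by (simp add: q_def)
qed

text \<open>Every cube has exactly one parent; uniqueness relies on children being nonempty.\<close>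

lemma sum_D_Suc: "(\<Sum>R\<in>D (Suc n). g R) = (\<Sum>Q\<in>D n. \<Sum>R\<in>ch D n Q. g R)"
proof -
  have ne: "R \<noteq> {}" if "R \<in> ch D n Q" for Q R
    using that empty_notin_D_Suc[of n] by (auto simp: ch_def)
  have "D (Suc n) = (\<Union>Q\<in>D n. ch D n Q)"
  proof
    show "D (Suc n) \<subseteq> (\<Union>Q\<in>D n. ch D n Q)"
    proof
      fix R assume R: "R \<in> D (Suc n)"
      then obtain x where "x \<in> R" using empty_notin_D_Suc[of n] by fastforce
      then show "R \<in> (\<Union>Q\<in>D n. ch D n Q)" using parent[OF R] by blast
    qed
  qed (auto simp: ch_def)
  moreover have "ch D n Q \<inter> ch D n Q' = {}" if "Q \<in> D n" "Q' \<in> D n" "Q \<noteq> Q'" for Q Q'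
  proof (rule ccontr)
    assume "ch D n Q \<inter> ch D n Q' \<noteq> {}"
    then obtain R where R: "R \<in> ch D n Q" "R \<in> ch D n Q'" by blast
    then obtain x where "x \<in> R" using ne by blast
    then have "x \<in> Q" "x \<in> Q'" using R by (auto simp: ch_def)
    then show False using D_unique that by blast
  qed
  ultimately show ?thesis by (simp add: sum.UNION_disjoint)
qed

lemma integral_expmart_le_one:
  assumes a: "\<alpha> \<le> 1/2" and f: "integrable M f"
  shows "(\<integral>x. expmart t f n x \<partial>M) \<le> 1"
proof (induction n)
  case 0
  show ?case by (simp add: expmart_def prob_space)
next
  case (Suc n)
  let ?W = "expmart t f"
  have "(\<integral>x. ?W (Suc n) x \<partial>M) = (\<Sum>R\<in>D (Suc n). ?W (Suc n) (pt R) * measure M R)"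
    by (rule integral_cubewise[OF cubewise_expmart])
  also have "\<dots> = (\<Sum>Q\<in>D n. \<Sum>R\<in>ch D n Q. ?W (Suc n) (pt R) * measure M R)"
    by (rule sum_D_Suc)
  also have "\<dots> \<le> (\<Sum>Q\<in>D n. ?W n (pt Q) * measure M Q)"
  proof (rule sum_mono)
    fix Q assume Q: "Q \<in> D n"
    show "(\<Sum>R\<in>ch D n Q. ?W (Suc n) (pt R) * measure M R) \<le> ?W n (pt Q) * measure M Q"
    proof (cases "Q = {}")
      case True
      then have "ch D n Q = {}" using empty_notin_D_Suc[of n] by (auto simp: ch_def)
      then show ?thesis using True by simp
    next
      case False
      \<comment> \<open>\<open>?W n\<close> is constant on the parent, so its value factors out of
        the sum over the children.\<close>
      have step: "?W (Suc n) (pt R) * measure M R =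
          ?W n (pt Q) * (measure M R * gtilt \<alpha> (t * (avg M f R - avg M f Q)))" if R: "R \<in> ch D n Q" for R
      proof -
        have RD: "R \<in> D (Suc n)" and RQ: "R \<subseteq> Q" using R by (auto simp: ch_def)
        have "R \<noteq> {}" using RD empty_notin_D_Suc[of n] by blast
        then have pR: "pt R \<in> R" by (rule pt_in)
        with RQ have pQ: "pt R \<in> Q" by blast
        show ?thesis
          unfolding expmart_Suc cexp_cube[OF RD pR] cexp_cube[OF Q pQ]
            cubewise_pt[OF cubewise_expmart Q pQ] by simp
      qed
      have "(\<Sum>R\<in>ch D n Q. ?W (Suc n) (pt R) * measure M R) =
          ?W n (pt Q) * (\<Sum>R\<in>ch D n Q. measure M R * gtilt \<alpha> (t * (avg M f R - avg M f Q)))"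
        unfolding sum_distrib_left by (rule sum.cong[OF refl step])
      also have "\<dots> \<le> ?W n (pt Q) * measure M Q"
        using sum_children_gtilt[OF a f Q False]
        by (intro mult_left_mono) (auto simp: expmart_def)
      finally show ?thesis .
    qed
  qed
  also have "\<dots> = (\<integral>x. ?W n x \<partial>M)"
    by (rule integral_cubewise[OF cubewise_expmart, symmetric])
  finally show ?case using Suc.IH by simp
qed

section \<open>Passage to an exponential moment of the limit\<close>

lemma AE_square_sum_le:
  assumes fin: "esssup M (square_fun M D f) < \<infinity>"
    and S: "S = enn2real (esssup M (square_fun M D f))"
  shows "AE x in M. \<forall>n. (\<Sum>k<n. (cexp (Suc k) f x - cexp k f x)\<^sup>2) \<le> S\<^sup>2"
  using esssup_AE[of "square_fun M D f" M] AE_space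
proof eventually_elim
  case (elim x)
  let ?q = "sq_sum M D f x"
  have le: "square_fun M D f x \<le> ennreal S"
    using elim(1) fin by (simp add: S)
  \<comment> \<open>Finiteness comes first because \<open>enn2real\<close> sends infinity to
    0.\<close>
  then have q: "?q \<noteq> \<infinity>" by (auto simp: square_fun_def top_unique)
  with le have "sqrt (enn2real ?q) \<le> S"
    by (simp add: square_fun_def S)
  then have "(sqrt (enn2real ?q))\<^sup>2 \<le> S\<^sup>2" by (intro power_mono) auto
  then have qS: "enn2real ?q \<le> S\<^sup>2" by simp
  show ?case
  proof
    fix n
    have "ennreal (\<Sum>k<n. (cexp (Suc k) f x - cexp k f x)\<^sup>2)
        = (\<Sum>k<n. ennreal ((cexp (Suc k) f x - cexp k f x)\<^sup>2))"
      by simp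
    also have "\<dots> \<le> ?q"
      unfolding sq_sum_eq[OF elim(2)] by (intro sum_le_suminf summableI) auto
    also have "\<dots> = ennreal (enn2real ?q)" using q by (simp add: less_top)
    finally have "(\<Sum>k<n. (cexp (Suc k) f x - cexp k f x)\<^sup>2) \<le> enn2real ?q"
      by simp
    with qS show "(\<Sum>k<n. (cexp (Suc k) f x - cexp k f x)\<^sup>2) \<le> S\<^sup>2" by simp
  qed
qed

lemma cexp_0: "x \<in> space M \<Longrightarrow> integrable M f \<Longrightarrow> cexp 0 f x = (\<integral>y. f y \<partial>M)"
proof -
  assume x: "x \<in> space M" and f: "integrable M f"
  obtain Q where Q: "Q \<in> D 0" "x \<in> Q" using x by (rule cube_obtain)
  then have "Q = space M" using D_F[of 0] F_0 by auto
  then show ?thesis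
    using cexp_cube[OF Q, of f] set_integral_space[OF f] by (simp add: avg_def prob_space)
qed

text \<open>Almost everywhere the compensator is at most \<open>t^2 * S^2 / (4 * \<alpha>)\<close>,
  so removing it costs a constant factor independent of \<open>n\<close>.\<close>

lemma exp_moment_cexp:
  assumes a: "\<alpha> \<le> 1/2" and f: "integrable M f"
    and fin: "esssup M (square_fun M D f) < \<infinity>"
    and S: "S = enn2real (esssup M (square_fun M D f))"
  shows "(\<integral>\<^sup>+x. ennreal (exp (t * (cexp n f x - (\<integral>y. f y \<partial>M)))) \<partial>M) \<le> ennreal (exp (t\<^sup>2 * S\<^sup>2 / (4 * \<alpha>)))"
proof -
  let ?c = "exp (t\<^sup>2 * S\<^sup>2 / (4 * \<alpha>))"
  have int: "integrable M (expmart t f n)"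
    by (rule integrable_cubewise[OF cubewise_expmart])
  have "(\<integral>\<^sup>+x. ennreal (exp (t * (cexp n f x - (\<integral>y. f y \<partial>M)))) \<partial>M) \<le> (\<integral>\<^sup>+x. ennreal (?c * expmart t f n x) \<partial>M)"
  proof (rule nn_integral_mono_AE)
    show "AE x in M. ennreal (exp (t * (cexp n f x - (\<integral>y. f y \<partial>M)))) \<le> ennreal (?c * expmart t f n x)"
      using AE_square_sum_le[OF fin S] AE_space
    proof eventually_elim
      case (elim x)
      have "t\<^sup>2 / (4 * \<alpha>) * (\<Sum>k<n. (cexp (Suc k) f x - cexp k f x)\<^sup>2) \<le> t\<^sup>2 / (4 * \<alpha>) * S\<^sup>2"
        using elim(1) alpha_pos by (intro mult_left_mono) auto
      then show ?case
        unfolding expmart_def exp_add[symmetric] cexp_0[OF elim(2) f]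
        by (intro ennreal_leI) simp
    qed
  qed
  also have "\<dots> = ennreal (\<integral>x. ?c * expmart t f n x \<partial>M)"
    by (intro nn_integral_eq_integral integrable_mult_right AE_I2 int) (simp add: expmart_def)
  also have "\<dots> \<le> ennreal ?c"
    using integral_expmart_le_one[OF a f, of t n]
    by (intro ennreal_leI) (simp add: mult_left_le)
  finally show ?thesis .
qed

text \<open>L1 convergence gives an almost everywhere convergent subsequence, along which Fatou's
  lemma preserves the uniform bound.\<close>

lemma exp_moment:
  assumes a: "\<alpha> \<le> 1/2" and f: "integrable M f"
    and fin: "esssup M (square_fun M D f) < \<infinity>"
    and S: "S = enn2real (esssup M (square_fun M D f))"
  shows "(\<integral>\<^sup>+x. ennreal (exp (t * (f x - (\<integral>y. f y \<partial>M)))) \<partial>M) \<le> ennreal (exp (t\<^sup>2 * S\<^sup>2 / (4 * \<alpha>)))"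
proof -
  let ?m = "\<integral>y. f y \<partial>M"
  have [measurable]: "cexp n f \<in> borel_measurable M" for n
    by (rule borel_measurable_integrable[OF integrable_cexp])
  have "(\<lambda>n. \<integral>x. norm (cexp n f x - f x) \<partial>M) \<longlonglongrightarrow> 0"
    using cexp_tendsto_L1[OF f] by simp
  from tendsto_L1_AE_subseq[OF _ this] f integrable_cexp
  obtain r where r: "AE x in M. (\<lambda>n. cexp (r n) f x - f x) \<longlonglongrightarrow> 0" by auto
  have "(\<integral>\<^sup>+x. ennreal (exp (t * (f x - ?m))) \<partial>M)
      = (\<integral>\<^sup>+x. liminf (\<lambda>n. ennreal (exp (t * (cexp (r n) f x - ?m)))) \<partial>M)"
  proof (rule nn_integral_cong_AE)
    show "AE x in M. ennreal (exp (t * (f x - ?m))) = liminf (\<lambda>n. ennreal (exp (t * (cexp (r n) f x - ?m))))"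
      using r
    proof eventually_elim
      case (elim x)
      then have "(\<lambda>n. cexp (r n) f x) \<longlonglongrightarrow> f x" using Lim_null by blast
      then have "(\<lambda>n. ennreal (exp (t * (cexp (r n) f x - ?m)))) \<longlonglongrightarrow> ennreal (exp (t * (f x - ?m)))"
        by (intro tendsto_intros)
      then show ?case by (intro lim_imp_Liminf[symmetric]) auto
    qed
  qed
  also have "\<dots> \<le> liminf (\<lambda>n. \<integral>\<^sup>+x. ennreal (exp (t * (cexp (r n) f x - ?m))) \<partial>M)"
    by (intro nn_integral_liminf) measurable
  also have "\<dots> \<le> liminf (\<lambda>n. ennreal (exp (t\<^sup>2 * S\<^sup>2 / (4 * \<alpha>))))"
    using exp_moment_cexp[OF a f fin S] by (intro Liminf_mono always_eventually) auto
  also have "\<dots> = ennreal (exp (t\<^sup>2 * S\<^sup>2 / (4 * \<alpha>)))" by (simp add: Liminf_const)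
  finally show ?thesis .
qed

end

section \<open>The tail bound by Markov's inequality\<close>

theorem theorem2p3:
  fixes M :: "'a measure" and F D :: "nat \<Rightarrow> 'a set set"
    and \<alpha> :: real and f :: "'a \<Rightarrow> real" and lam :: real
  assumes "prob_space M"
    and "atomic_filtration M F D"
    and "homogeneous M D \<alpha>"
    and "0 < \<alpha>" and "\<alpha> \<le> 1/2"
    and "integrable M f"
    and "esssup M (square_fun M D f) < \<infinity>"
    and "lam \<ge> 0"
  shows "measure M {x \<in> space M. f x - (\<integral>y. f y \<partial>M) > lam}
           \<le> exp (- \<alpha> * lam\<^sup>2 / (enn2real (esssup M (square_fun M D f)))\<^sup>2)"
proof -
  interpret prob_space M by fact
  interpret homogeneous_filtration M F D \<alpha>
    by unfold_locales fact+
  define S where "S = enn2real (esssup M (square_fun M D f))"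
  let ?m = "\<integral>y. f y \<partial>M"
  let ?A = "{x \<in> space M. f x - ?m > lam}"
  have fm [measurable]: "f \<in> borel_measurable M" using assms(6) by simp
  have "measure M ?A \<le> exp (- \<alpha> * lam\<^sup>2 / S\<^sup>2)"
  proof (cases "S = 0")
    \<comment> \<open>Division by zero yields 0, so the right-hand side is
      \<open>exp 0 = 1\<close>.\<close>
    case True
    then show ?thesis by simp
  next
    case False
    \<comment> \<open>The minimiser of \<open>- t * lam + t^2 * S^2 / (4 * \<alpha>)\<close>, the
      exponent produced by Markov's inequality.\<close>
    define t where "t = 2 * \<alpha> * lam / S\<^sup>2"
    have t: "0 \<le> t" using assms(4,8) by (simp add: t_def)
    let ?u = "\<lambda>x. ennreal (exp (t * (f x - ?m)))"
    have "emeasure M ?A \<le> emeasure M {x \<in> space M. 1 \<le> ennreal (exp (- (t * lam))) * ?u x}"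
    proof (rule emeasure_mono)
      show "?A \<subseteq> {x \<in> space M. 1 \<le> ennreal (exp (- (t * lam))) * ?u x}"
      proof safe
        fix x assume "lam < f x - ?m"
        then have "t * lam \<le> t * (f x - ?m)" using t by (intro mult_left_mono) auto
        then show "1 \<le> ennreal (exp (- (t * lam))) * ?u x"
          by (simp add: ennreal_mult[symmetric] exp_add[symmetric])
      qed
    qed measurable
    also have "\<dots> \<le> ennreal (exp (- (t * lam))) * (\<integral>\<^sup>+x. ?u x * indicator (space M) x \<partial>M)"
      by (rule nn_integral_Markov_inequality) auto
    also have "(\<integral>\<^sup>+x. ?u x * indicator (space M) x \<partial>M) = (\<integral>\<^sup>+x. ?u x \<partial>M)"
      by (intro nn_integral_cong) auto
    also have "\<dots> \<le> ennreal (exp (t\<^sup>2 * S\<^sup>2 / (4 * \<alpha>)))"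
      by (rule exp_moment[OF assms(5,6,7) S_def])
    also have "ennreal (exp (- (t * lam))) * ennreal (exp (t\<^sup>2 * S\<^sup>2 / (4 * \<alpha>)))
        = ennreal (exp (- (t * lam) + t\<^sup>2 * S\<^sup>2 / (4 * \<alpha>)))"
      by (simp only: exp_add ennreal_mult exp_ge_zero)
    also have "- (t * lam) + t\<^sup>2 * S\<^sup>2 / (4 * \<alpha>) = - \<alpha> * lam\<^sup>2 / S\<^sup>2"
      using False assms(4) by (simp add: t_def field_simps power2_eq_square)
    finally have "emeasure M ?A \<le> ennreal (exp (- \<alpha> * lam\<^sup>2 / S\<^sup>2))"
      by (simp add: mult_left_mono)
    then show ?thesis by (simp add: emeasure_eq_measure)
  qed
  then show ?thesis by (simp add: S_def)
qed

end
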